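(* Let $G$ be a finite undirected graph (multiple edges and loops allowed). Then the semilattice of idempotents of the inverse semigroup $\mathrm{Iisg}(G)$, with the order $e\le f$ if and only if $e=ef$, forms a Boolean algebra.
   Context: Graphs are finite and undirected and may have multiple edges and loops; the empty graph $\emptyset$ counts as a graph and the empty map $\mu_0:\emptyset\to\emptyset$ counts as a graph isomorphism. For $X\subseteq V(G)$, $G[X]$ is the vertex induced subgraph with vertex set $X$ and all edges of $G$ whose ends lie in $X$. For a graph $G$, $\mathrm{Iisg}(G)$ is the set of all graph isomorphisms $\varphi:H\to J$ (bijections on vertices and on edges preserving incidence) where $H$ and $J$ are vertex induced subgraphs of $G$. For $\varphi,\psi\in\mathrm{Iisg}(G)$ the product $\psi\circ\varphi$ is the composition of partial maps, with domain $\varphi^{-1}(\mathrm{Im}(\varphi)\cap\mathrm{Dom}(\psi))$ and image $\psi(\mathrm{Im}(\varphi)\cap\mathrm{Dom}(\psi))$. With this product $\mathrm{Iisg}(G)$ is an inverse semigroup. *)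

theory Defs
  imports "HOL-Algebra.Lattice"
begin

section \<open>Finite undirected multigraphs\<close>

text \<open>
  A loop is an edge with exactly one end.  The ends function is unspecified outside the edge set.
\<close>

record ('v, 'e) multigraph =
  verts :: "'v set"
  edges :: "'e set"
  ends :: "'e \<Rightarrow> 'v set"

definition finite_multigraph :: "('v, 'e) multigraph \<Rightarrow> bool" where
  "finite_multigraph G \<longleftrightarrow> finite (verts G) \<and> finite (edges G) \<and>
     (\<forall>e\<in>edges G. ends G e \<subseteq> verts G \<and> (card (ends G e) = 1 \<or> card (ends G e) = 2))"

definition induced :: "('v, 'e) multigraph \<Rightarrow> 'v set \<Rightarrow> ('v, 'e) multigraph" where
  "induced G X = G\<lparr>verts := X, edges := {e \<in> edges G. ends G e \<subseteq> X}\<rparr>"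


section \<open>Isomorphisms between induced subgraphs\<close>

text \<open>
  A graph isomorphism is a pair of a vertex map and an edge map.  Both are partial maps on the
  ambient types whose domains are exactly the vertex set and the edge set of the source, and whose
  ranges are those of the target.
\<close>

type_synonym ('v, 'e) pmap = "('v \<rightharpoonup> 'v) \<times> ('e \<rightharpoonup> 'e)"

definition graph_iso ::
  "('v, 'e) multigraph \<Rightarrow> ('v, 'e) multigraph \<Rightarrow> ('v, 'e) pmap \<Rightarrow> bool" where
  "graph_iso H J \<phi> \<longleftrightarrow>
     dom (fst \<phi>) = verts H \<and> ran (fst \<phi>) = verts J \<and> inj_on (fst \<phi>) (dom (fst \<phi>)) \<and>
     dom (snd \<phi>) = edges H \<and> ran (snd \<phi>) = edges J \<and> inj_on (snd \<phi>) (dom (snd \<phi>)) \<and>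
     (\<forall>v v' e e'. fst \<phi> v = Some v' \<longrightarrow> snd \<phi> e = Some e' \<longrightarrow>
        (v \<in> ends H e \<longleftrightarrow> v' \<in> ends J e'))"

definition Iisg :: "('v, 'e) multigraph \<Rightarrow> ('v, 'e) pmap set" where
  "Iisg G = {\<phi>. \<exists>X Y. X \<subseteq> verts G \<and> Y \<subseteq> verts G \<and> graph_iso (induced G X) (induced G Y) \<phi>}"

text \<open>
  The product \<open>\<psi> \<circ> \<phi>\<close>: apply \<open>\<phi>\<close> first.  By definition of \<^const>\<open>map_comp\<close> it is defined exactly at
  the points of the domain of \<open>\<phi>\<close> whose image lies in the domain of \<open>\<psi>\<close>.
\<close>

definition pcomp :: "('v, 'e) pmap \<Rightarrow> ('v, 'e) pmap \<Rightarrow> ('v, 'e) pmap" where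
  "pcomp \<psi> \<phi> = (fst \<psi> \<circ>\<^sub>m fst \<phi>, snd \<psi> \<circ>\<^sub>m snd \<phi>)"


section \<open>Inverse semigroups, idempotents and Boolean algebras\<close>

locale inverse_semigroup =
  fixes S :: "'a set" and mul :: "'a \<Rightarrow> 'a \<Rightarrow> 'a"
  assumes closed: "x \<in> S \<Longrightarrow> y \<in> S \<Longrightarrow> mul x y \<in> S"
    and assoc: "x \<in> S \<Longrightarrow> y \<in> S \<Longrightarrow> z \<in> S \<Longrightarrow> mul (mul x y) z = mul x (mul y z)"
    and inverse_ex1: "x \<in> S \<Longrightarrow> \<exists>!y. y \<in> S \<and> mul (mul x y) x = x \<and> mul (mul y x) y = y"

definition idempotents :: "'a set \<Rightarrow> ('a \<Rightarrow> 'a \<Rightarrow> 'a) \<Rightarrow> 'a set" where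
  "idempotents S mul = {e \<in> S. mul e e = e}"

definition idempotent_order :: "'a set \<Rightarrow> ('a \<Rightarrow> 'a \<Rightarrow> 'a) \<Rightarrow> 'a gorder" where
  "idempotent_order S mul =
     \<lparr>carrier = idempotents S mul, eq = (=), le = (\<lambda>e f. e = mul e f)\<rparr>"

text \<open>A Boolean algebra, as an ordered set, is a bounded distributive complemented lattice.\<close>

locale boolean_lattice = bounded_lattice L for L (structure) +
  assumes meet_join_distrib:
      "x \<in> carrier L \<Longrightarrow> y \<in> carrier L \<Longrightarrow> z \<in> carrier L \<Longrightarrow>
         x \<sqinter> (y \<squnion> z) = (x \<sqinter> y) \<squnion> (x \<sqinter> z)"
    and complement_ex:
      "x \<in> carrier L \<Longrightarrow> \<exists>y\<in>carrier L. x \<sqinter> y = \<bottom> \<and> x \<squnion> y = \<top>"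


section \<open>The inverse semigroup of induced subgraph isomorphisms\<close>

lemma Iisg_iff:
  "\<phi> \<in> Iisg G \<longleftrightarrow>
     dom (fst \<phi>) \<subseteq> verts G \<and> ran (fst \<phi>) \<subseteq> verts G \<and> inj_on (fst \<phi>) (dom (fst \<phi>)) \<and>
     dom (snd \<phi>) = {e \<in> edges G. ends G e \<subseteq> dom (fst \<phi>)} \<and>
     ran (snd \<phi>) = {e \<in> edges G. ends G e \<subseteq> ran (fst \<phi>)} \<and> inj_on (snd \<phi>) (dom (snd \<phi>)) \<and>
     (\<forall>v v' e e'. fst \<phi> v = Some v' \<longrightarrow> snd \<phi> e = Some e' \<longrightarrow>
        (v \<in> ends G e \<longleftrightarrow> v' \<in> ends G e'))"
  unfolding Iisg_def graph_iso_def induced_def by auto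

lemma pinj_iff:
  "inj_on f (dom f) \<longleftrightarrow> (\<forall>a a' b. f a = Some b \<longrightarrow> f a' = Some b \<longrightarrow> a = a')"
  unfolding inj_on_def dom_def by fastforce

lemma pinj_inverse:
  assumes "inj_on f (dom f)"
  obtains g where "\<And>a b. g b = Some a \<longleftrightarrow> f a = Some b"
proof
  fix a b
  show "(\<lambda>b. if b \<in> ran f then Some (SOME a. f a = Some b) else None) b = Some a
          \<longleftrightarrow> f a = Some b"
  proof (cases "b \<in> ran f")
    case True
    then have "f (SOME a. f a = Some b) = Some b"
      by (auto simp: ran_def intro: someI)
    then show ?thesis
      using True assms unfolding pinj_iff by auto
  next
    case False
    then show ?thesis by (auto simp: ran_def)
  qed
qed

lemma pinj_comp_inverse:
  assumes "\<And>a b. g b = Some a \<longleftrightarrow> f a = Some b"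
  shows "(f \<circ>\<^sub>m g) \<circ>\<^sub>m f = f"
proof
  fix a
  show "((f \<circ>\<^sub>m g) \<circ>\<^sub>m f) a = f a"
    using assms by (cases "f a") (auto simp: map_comp_def split: option.split)
qed

lemma pinj_inverse_unique:
  assumes f: "inj_on f (dom f)" and g: "inj_on g (dom g)"
    and fgf: "(f \<circ>\<^sub>m g) \<circ>\<^sub>m f = f" and gfg: "(g \<circ>\<^sub>m f) \<circ>\<^sub>m g = g"
  shows "g b = Some a \<longleftrightarrow> f a = Some b"
proof -
  have *: "k b = Some a"
    if inj: "inj_on h (dom h)" and eq: "(h \<circ>\<^sub>m k) \<circ>\<^sub>m h = h" and ab: "h a = Some b" for h :: "'x \<rightharpoonup> 'y" and k a b
  proof -
    have "((h \<circ>\<^sub>m k) \<circ>\<^sub>m h) a = Some b"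
      using eq ab by simp
    then obtain c where "k b = Some c" "h c = Some b"
      using ab by (auto simp: map_comp_Some_iff)
    then show ?thesis
      using inj ab unfolding pinj_iff by metis
  qed
  show ?thesis
    using *[OF f fgf] *[OF g gfg] by metis
qed

lemma ran_comp: "ran (g \<circ>\<^sub>m f) = {c. \<exists>a b. f a = Some b \<and> g b = Some c}"
  by (auto simp: ran_def map_comp_Some_iff)

lemma dom_comp: "dom (g \<circ>\<^sub>m f) = {a. \<exists>b c. f a = Some b \<and> g b = Some c}"
  by (auto simp: dom_def map_comp_Some_iff)

lemma Iisg_closed:
  assumes \<psi>: "\<psi> \<in> Iisg G" and \<phi>: "\<phi> \<in> Iisg G"
  shows "pcomp \<psi> \<phi> \<in> Iisg G"
proof -
  obtain f g h k where eqs: "\<phi> = (f, g)" "\<psi> = (h, k)" by fastforce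
  have f: "dom f \<subseteq> verts G" "ran f \<subseteq> verts G"
      "\<And>a a' b. f a = Some b \<Longrightarrow> f a' = Some b \<Longrightarrow> a = a'"
    and g: "\<And>e. e \<in> dom g \<longleftrightarrow> e \<in> edges G \<and> ends G e \<subseteq> dom f"
      "\<And>e. e \<in> ran g \<longleftrightarrow> e \<in> edges G \<and> ends G e \<subseteq> ran f"
      "\<And>a a' b. g a = Some b \<Longrightarrow> g a' = Some b \<Longrightarrow> a = a'"
    and fg: "\<And>v v' e e'. f v = Some v' \<Longrightarrow> g e = Some e' \<Longrightarrow> v \<in> ends G e \<longleftrightarrow> v' \<in> ends G e'"
    using \<phi> unfolding Iisg_iff eqs pinj_iff fst_conv snd_conv by (blast | force)+
  have h: "dom h \<subseteq> verts G" "ran h \<subseteq> verts G"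
      "\<And>a a' b. h a = Some b \<Longrightarrow> h a' = Some b \<Longrightarrow> a = a'"
    and k: "\<And>e. e \<in> dom k \<longleftrightarrow> e \<in> edges G \<and> ends G e \<subseteq> dom h"
      "\<And>e. e \<in> ran k \<longleftrightarrow> e \<in> edges G \<and> ends G e \<subseteq> ran h"
      "\<And>a a' b. k a = Some b \<Longrightarrow> k a' = Some b \<Longrightarrow> a = a'"
    and hk: "\<And>v v' e e'. h v = Some v' \<Longrightarrow> k e = Some e' \<Longrightarrow> v \<in> ends G e \<longleftrightarrow> v' \<in> ends G e'"
    using \<psi> unfolding Iisg_iff eqs pinj_iff fst_conv snd_conv by (blast | force)+
  have d: "e \<in> dom (k \<circ>\<^sub>m g) \<longleftrightarrow> e \<in> edges G \<and> ends G e \<subseteq> dom (h \<circ>\<^sub>m f)" for e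
  proof
    assume "e \<in> dom (k \<circ>\<^sub>m g)"
    then obtain e' where e': "g e = Some e'" "e' \<in> dom k" by (auto simp: dom_comp)
    have e: "e \<in> edges G" "ends G e \<subseteq> dom f" using g(1)[of e] e' by blast+
    have "v \<in> dom (h \<circ>\<^sub>m f)" if v: "v \<in> ends G e" for v
    proof -
      obtain w where w: "f v = Some w" using v e by blast
      then have "w \<in> dom h" using fg[OF w e'(1)] v k(1)[of e'] e' by blast
      then show ?thesis using w by (auto simp: dom_comp)
    qed
    then show "e \<in> edges G \<and> ends G e \<subseteq> dom (h \<circ>\<^sub>m f)" using e by blast
  next
    assume e: "e \<in> edges G \<and> ends G e \<subseteq> dom (h \<circ>\<^sub>m f)"
    then have "ends G e \<subseteq> dom f" by (fastforce simp: dom_comp)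
    then obtain e' where e': "g e = Some e'" using g(1)[of e] e by blast
    then have r: "e' \<in> edges G" "ends G e' \<subseteq> ran f" using g(2)[of e'] ranI by fast+
    have "w \<in> dom h" if w: "w \<in> ends G e'" for w
    proof -
      obtain v where v: "f v = Some w" using w r by (auto simp: ran_def)
      then have "v \<in> ends G e" using fg[OF v e'] w by blast
      then show ?thesis using e v by (fastforce simp: dom_comp)
    qed
    then have "e' \<in> dom k" using k(1) r by blast
    then show "e \<in> dom (k \<circ>\<^sub>m g)" using e' by (auto simp: dom_comp)
  qed
  have r: "e \<in> ran (k \<circ>\<^sub>m g) \<longleftrightarrow> e \<in> edges G \<and> ends G e \<subseteq> ran (h \<circ>\<^sub>m f)" for e
  proof
    assume "e \<in> ran (k \<circ>\<^sub>m g)"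
    then obtain e' where e': "k e' = Some e" "e' \<in> ran g"
      unfolding ran_comp by (blast intro: ranI)
    have e: "e \<in> edges G" "ends G e \<subseteq> ran h" using k(2)[of e] e' ranI by fast+
    have "v \<in> ran (h \<circ>\<^sub>m f)" if v: "v \<in> ends G e" for v
    proof -
      obtain w where w: "h w = Some v" using v e by (auto simp: ran_def)
      then have "w \<in> ran f" using hk[OF w e'(1)] v g(2)[of e'] e' by blast
      then show ?thesis using w unfolding ran_comp by (auto simp: ran_def)
    qed
    then show "e \<in> edges G \<and> ends G e \<subseteq> ran (h \<circ>\<^sub>m f)" using e by blast
  next
    assume e: "e \<in> edges G \<and> ends G e \<subseteq> ran (h \<circ>\<^sub>m f)"
    then have "ends G e \<subseteq> ran h" unfolding ran_comp by (blast intro: ranI)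
    then obtain e' where e': "k e' = Some e" using k(2)[of e] e by (auto simp: ran_def)
    then have r: "e' \<in> edges G" "ends G e' \<subseteq> dom h" using k(1)[of e'] by blast+
    have "w \<in> ran f" if w: "w \<in> ends G e'" for w
    proof -
      obtain v where v: "h w = Some v" using w r by blast
      then have "v \<in> ends G e" using hk[OF v e'] w by blast
      then have "v \<in> ran (h \<circ>\<^sub>m f)" using e by blast
      then obtain a b where "f a = Some b" "h b = Some v" unfolding ran_comp by blast
      then show ?thesis using h(3)[OF v] ranI by metis
    qed
    then have "e' \<in> ran g" using g(2) r by blast
    then show "e \<in> ran (k \<circ>\<^sub>m g)" using e' unfolding ran_comp by (auto simp: ran_def)
  qed
  have "dom (h \<circ>\<^sub>m f) \<subseteq> verts G" using f(1) unfolding dom_comp by blast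
  moreover have "ran (h \<circ>\<^sub>m f) \<subseteq> verts G" using h(2) unfolding ran_comp by (blast intro: ranI)
  moreover have "inj_on (h \<circ>\<^sub>m f) (dom (h \<circ>\<^sub>m f))"
    unfolding pinj_iff map_comp_Some_iff using f(3) h(3) by metis
  moreover have "inj_on (k \<circ>\<^sub>m g) (dom (k \<circ>\<^sub>m g))"
    unfolding pinj_iff map_comp_Some_iff using g(3) k(3) by metis
  moreover have "\<forall>v v' e e'. (h \<circ>\<^sub>m f) v = Some v' \<longrightarrow> (k \<circ>\<^sub>m g) e = Some e' \<longrightarrow>
      (v \<in> ends G e \<longleftrightarrow> v' \<in> ends G e')"
    unfolding map_comp_Some_iff using fg hk by metis
  ultimately show ?thesis
    unfolding Iisg_iff pcomp_def eqs fst_conv snd_conv using d r by blast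
qed

lemma map_comp_assoc: "(h \<circ>\<^sub>m g) \<circ>\<^sub>m f = h \<circ>\<^sub>m (g \<circ>\<^sub>m f)"
  by (auto simp: map_comp_def fun_eq_iff split: option.split)

theorem inverse_semigroup_Iisg: "inverse_semigroup (Iisg G) pcomp"
proof
  fix \<phi> assume \<phi>: "\<phi> \<in> Iisg G"
  obtain f g where eq: "\<phi> = (f, g)" by fastforce
  have inj: "inj_on f (dom f)" "inj_on g (dom g)"
    using \<phi> unfolding Iisg_iff eq by auto
  obtain f' where f': "\<And>a b. f' b = Some a \<longleftrightarrow> f a = Some b"
    using pinj_inverse[OF inj(1)] by blast
  obtain g' where g': "\<And>a b. g' b = Some a \<longleftrightarrow> g a = Some b"
    using pinj_inverse[OF inj(2)] by blast
  have dr: "dom f' = ran f" "ran f' = dom f" "dom g' = ran g" "ran g' = dom g"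
    by (auto simp: dom_def ran_def f' g')
  have "inj_on f' (dom f')" "inj_on g' (dom g')"
    unfolding pinj_iff f' g' by auto
  then have mem: "(f', g') \<in> Iisg G"
    using \<phi> unfolding Iisg_iff eq fst_conv snd_conv dr f' g' by metis
  show "\<exists>!\<psi>. \<psi> \<in> Iisg G \<and> pcomp (pcomp \<phi> \<psi>) \<phi> = \<phi> \<and> pcomp (pcomp \<psi> \<phi>) \<psi> = \<psi>"
  proof (rule ex1I[of _ "(f', g')"])
    show "(f', g') \<in> Iisg G \<and> pcomp (pcomp \<phi> (f', g')) \<phi> = \<phi> \<and>
        pcomp (pcomp (f', g') \<phi>) (f', g') = (f', g')"
      using mem by (simp add: eq pcomp_def pinj_comp_inverse f' g')
  next
    fix \<psi> assume \<psi>: "\<psi> \<in> Iisg G \<and> pcomp (pcomp \<phi> \<psi>) \<phi> = \<phi> \<and> pcomp (pcomp \<psi> \<phi>) \<psi> = \<psi>"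
    obtain h k where eq': "\<psi> = (h, k)" by fastforce
    have inj': "inj_on h (dom h)" "inj_on k (dom k)"
      using \<psi> unfolding Iisg_iff eq' by auto
    have "h b = Some a \<longleftrightarrow> f a = Some b" for a b
      using pinj_inverse_unique[OF inj(1) inj'(1)] \<psi> by (simp add: eq eq' pcomp_def)
    moreover have "k b = Some a \<longleftrightarrow> g a = Some b" for a b
      using pinj_inverse_unique[OF inj(2) inj'(2)] \<psi> by (simp add: eq eq' pcomp_def)
    ultimately have "h b = f' b" "k c = g' c" for b c
      by (metis f' option.exhaust, metis g' option.exhaust)
    then show "\<psi> = (f', g')" unfolding eq' by auto
  qed
qed (rule Iisg_closed, simp_all add: pcomp_def map_comp_assoc)

end

(* An injective partial map composed with itself equals itself only if it is the identity on its
   domain, so the idempotents of Iisg G are the identities of the induced subgraphs G[X].  The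
   product of the identities of G[X] and G[Y] is that of G[X \<inter> Y], so X \<mapsto> id of G[X] is an order
   isomorphism from the powerset of V(G). *)
theory Submission
  imports Defs
begin

text \<open>As \<open>f\<close> preserves and reflects the order, the Boolean structure of
  \<open>Pow V\<close> carries over: union, intersection, the empty set and \<open>V\<close> give
  join, meet, bottom and top. The assumption \<open>eq\<close> is there because an ordered structure
  carries its own equality, and antisymmetry refers to that one.\<close>

lemma boolean_lattice_powerset_image:
  fixes L (structure)
  assumes eq: "(.=) = (=)"
    and carrier: "carrier L = f ` Pow V"
    and le: "\<And>X Y. X \<subseteq> V \<Longrightarrow> Y \<subseteq> V \<Longrightarrow> f X \<sqsubseteq> f Y \<longleftrightarrow> X \<subseteq> Y"
  shows "boolean_lattice L"
proof -
  interpret partial_order L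
    by standard (auto simp: eq carrier le)
  have least: "least L (f (X \<union> Y)) (Upper L {f X, f Y})" if "X \<subseteq> V" "Y \<subseteq> V" for X Y
    using that by (auto simp: least_def Upper_def carrier le)
  have greatest: "greatest L (f (X \<inter> Y)) (Lower L {f X, f Y})" if "X \<subseteq> V" "Y \<subseteq> V" for X Y
    using that by (auto simp: greatest_def Lower_def carrier le le_infI1)
  interpret bounded_lattice L
  proof
    show "\<exists>s. least L s (Upper L {x, y})" if "x \<in> carrier L" "y \<in> carrier L" for x y
      using that least by (auto simp: carrier)
    show "\<exists>s. greatest L s (Lower L {x, y})" if "x \<in> carrier L" "y \<in> carrier L" for x y
      using that greatest by (auto simp: carrier)
    have "least L (f {}) (carrier L)"
      by (auto simp: least_def carrier le)
    then show "\<exists>x. least L x (carrier L)" ..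
    have "greatest L (f V) (carrier L)"
      by (auto simp: greatest_def carrier le)
    then show "\<exists>x. greatest L x (carrier L)" ..
  qed
  have mem: "f X \<in> carrier L" if "X \<subseteq> V" for X
    using that by (simp add: carrier)
  \<comment> \<open>The lattice operations are chosen as some least upper or greatest lower bound,
    so uniqueness of such bounds identifies them with the explicit ones.\<close>
  have join: "f X \<squnion> f Y = f (X \<union> Y)" if "X \<subseteq> V" "Y \<subseteq> V" for X Y
    by (rule joinI) (auto simp: mem that intro: least_unique[OF _ least[OF that]])
  have meet: "f X \<sqinter> f Y = f (X \<inter> Y)" if "X \<subseteq> V" "Y \<subseteq> V" for X Y
    by (rule meetI) (auto simp: mem that intro: greatest_unique[OF _ greatest[OF that]])
  have bottom: "\<bottom> = f {}"
    by (rule bottom_eq[symmetric]) (auto simp: carrier le)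
  have top: "\<top> = f V"
    by (rule top_eq[symmetric]) (auto simp: carrier le)
  show ?thesis
  proof
    fix x y z
    assume "x \<in> carrier L" "y \<in> carrier L" "z \<in> carrier L"
    then obtain X Y Z where "X \<subseteq> V" "Y \<subseteq> V" "Z \<subseteq> V" "x = f X" "y = f Y" "z = f Z"
      by (auto simp: carrier)
    then show "x \<sqinter> (y \<squnion> z) = (x \<sqinter> y) \<squnion> (x \<sqinter> z)"
      by (simp add: join meet le_supI le_infI1 Int_Un_distrib)
  next
    fix x
    assume "x \<in> carrier L"
    then obtain X where X: "X \<subseteq> V" "x = f X"
      by (auto simp: carrier)
    \<comment> \<open>The complement is taken relative to \<open>V\<close>; the union is all of
      \<open>V\<close> because \<open>X\<close> lies in \<open>V\<close>.\<close>
    then have "f X \<sqinter> f (V - X) = \<bottom>" "f X \<squnion> f (V - X) = \<top>"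
      by (simp_all add: join meet bottom top Un_absorb1)
    then show "\<exists>y\<in>carrier L. x \<sqinter> y = \<bottom> \<and> x \<squnion> y = \<top>"
      using X mem[of "V - X"] by blast
  qed
qed

text \<open>If \<open>f\<close> sends \<open>a\<close> to \<open>b\<close>, idempotence makes
  \<open>f\<close> send \<open>b\<close> to \<open>b\<close>; then \<open>a\<close> and
  \<open>b\<close> have the same image, so injectivity gives \<open>a = b\<close>.\<close>

lemma pinj_idem_iff:
  assumes "inj_on f (dom f)"
  shows "f \<circ>\<^sub>m f = f \<longleftrightarrow> f = Some |` dom f"
proof
  assume idem: "f \<circ>\<^sub>m f = f"
  have "f a = Some a" if "f a = Some b" for a b
  proof -
    have "f b = Some b"
      using fun_cong[OF idem, of a] that by simp
    then show ?thesis
      using assms that unfolding pinj_iff by metis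
  qed
  then show "f = Some |` dom f"
    by (force simp: restrict_map_def fun_eq_iff dom_def)
next
  assume *: "f = Some |` dom f"
  have "f a = Some a" if "a \<in> dom f" for a
    using fun_cong[OF *, of a] that by simp
  then show "f \<circ>\<^sub>m f = f"
    by (force simp: map_comp_def fun_eq_iff dom_def split: option.split)
qed

definition induced_id :: "('v, 'e) multigraph \<Rightarrow> 'v set \<Rightarrow> ('v, 'e) pmap" where
  "induced_id G X = (Some |` X, Some |` edges (induced G X))"

lemma edges_induced: "edges (induced G X) = {e \<in> edges G. ends G e \<subseteq> X}"
  by (simp add: induced_def)

lemma restrict_Some_eq_Some: "(Some |` A) a = Some b \<longleftrightarrow> a \<in> A \<and> b = a"
  by (auto simp: restrict_map_def)

lemma dom_restrict_Some: "dom (Some |` A) = A"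
  by (auto simp: dom_def restrict_Some_eq_Some)

lemma ran_restrict_Some: "ran (Some |` A) = A"
  by (auto simp: ran_def restrict_Some_eq_Some)

lemma restrict_Some_comp: "(Some |` A) \<circ>\<^sub>m (Some |` B) = Some |` (A \<inter> B)"
  by (auto simp: map_comp_def restrict_map_def fun_eq_iff)

text \<open>Partial identities compose to the identity on the common domain, and an edge has its
  ends in both \<open>X\<close> and \<open>Y\<close> exactly when they lie in the
  intersection.\<close>

lemma induced_id_comp: "pcomp (induced_id G X) (induced_id G Y) = induced_id G (X \<inter> Y)"
proof -
  have "edges (induced G X) \<inter> edges (induced G Y) = edges (induced G (X \<inter> Y))"
    by (auto simp: edges_induced)
  then show ?thesis
    by (simp add: induced_id_def pcomp_def restrict_Some_comp)
qed

text \<open>The domain of the vertex map recovers \<open>X\<close>.\<close>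

lemma induced_id_eq_iff: "induced_id G X = induced_id G Y \<longleftrightarrow> X = Y"
  by (metis dom_restrict_Some fst_conv induced_id_def)

lemma induced_id_in_Iisg: "X \<subseteq> verts G \<Longrightarrow> induced_id G X \<in> Iisg G"
  by (auto simp: Iisg_iff induced_id_def dom_restrict_Some ran_restrict_Some
      restrict_Some_eq_Some edges_induced inj_on_def)

lemma idempotents_Iisg: "idempotents (Iisg G) pcomp = induced_id G ` Pow (verts G)"
proof (intro equalityI subsetI)
  fix \<phi>
  assume "\<phi> \<in> idempotents (Iisg G) pcomp"
  then have \<phi>: "\<phi> \<in> Iisg G" and idem: "pcomp \<phi> \<phi> = \<phi>"
    by (simp_all add: idempotents_def)
  from idem have "fst \<phi> \<circ>\<^sub>m fst \<phi> = fst \<phi>" "snd \<phi> \<circ>\<^sub>m snd \<phi> = snd \<phi>"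
    by (metis fst_conv pcomp_def, metis snd_conv pcomp_def)
  then have "fst \<phi> = Some |` dom (fst \<phi>)" "snd \<phi> = Some |` dom (snd \<phi>)"
    using \<phi> pinj_idem_iff unfolding Iisg_iff by blast+
  \<comment> \<open>Because the source is an induced subgraph, the vertex domain dictates the edge
    domain, so a single vertex set describes the whole pair.\<close>
  moreover have "dom (snd \<phi>) = edges (induced G (dom (fst \<phi>)))"
    using \<phi> by (simp add: Iisg_iff edges_induced)
  ultimately have "\<phi> = induced_id G (dom (fst \<phi>))"
    by (metis induced_id_def prod.collapse)
  moreover have "dom (fst \<phi>) \<subseteq> verts G"
    using \<phi> by (simp add: Iisg_iff)
  ultimately show "\<phi> \<in> induced_id G ` Pow (verts G)"
    by blast
next
  fix \<phi>
  assume "\<phi> \<in> induced_id G ` Pow (verts G)"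
  then show "\<phi> \<in> idempotents (Iisg G) pcomp"
    by (auto simp: idempotents_def induced_id_in_Iisg induced_id_comp)
qed

theorem theorem3p3:
  fixes G :: "('v, 'e) multigraph"
  assumes "finite_multigraph G"
  shows "boolean_lattice (idempotent_order (Iisg G) pcomp)"
  \<comment> \<open>For the identities on \<open>X\<close> and \<open>Y\<close> the order
    \<open>e = ef\<close> reads \<open>X = X \<inter> Y\<close>, that is,
    \<open>X \<subseteq> Y\<close>.\<close>
  by (rule boolean_lattice_powerset_image[where f = "induced_id G" and V = "verts G"])
    (auto simp: idempotent_order_def idempotents_Iisg induced_id_comp induced_id_eq_iff)

end
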